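(* Let $S_{i(j)(k)}^{l(1)(1)}$ be the vertical curvature d-tensor of the Cartan canonical connection of the rheonomic Berwald-Moór metric $\mathring F(t,y)=\sqrt{h^{11}(t)}\,\sqrt[4]{y_1^1y_1^2y_1^3y_1^4}$. For indices in $\{1,2,3,4\}$, and with no summation over repeated indices in the formulas below, the following hold: 1. $S_{i(j)(k)}^{l(1)(1)}=0$ for $i,j,k,l$ pairwise distinct; 2. $S_{i(i)(k)}^{l(1)(1)}=-\dfrac{1}{16}\dfrac{y_1^l}{(y_1^i)^2y_1^k}$ for $i,k,l$ pairwise distinct; 3. $S_{i(j)(i)}^{l(1)(1)}=\dfrac{1}{16}\dfrac{y_1^l}{(y_1^i)^2y_1^j}$ for $i,j,l$ pairwise distinct; 4. $S_{i(j)(k)}^{i(1)(1)}=0$ for $i,j,k$ pairwise distinct; 5. $S_{i(l)(k)}^{l(1)(1)}=\dfrac{1}{16\,y_1^iy_1^k}$ for $i,k,l$ pairwise distinct; 6. $S_{i(j)(l)}^{l(1)(1)}=-\dfrac{1}{16\,y_1^iy_1^j}$ for $i,j,l$ pairwise distinct; 7. $S_{i(i)(l)}^{l(1)(1)}=\dfrac{1}{8(y_1^i)^2}$ for $i\neq l$; 8. $S_{i(l)(i)}^{l(1)(1)}=-\dfrac{1}{8(y_1^i)^2}$ for $i\neq l$; 9. $S_{l(l)(k)}^{l(1)(1)}=0$ for $k\neq l$; 10. $S_{l(j)(l)}^{l(1)(1)}=0$ for $j\neq l$.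
   Context: All indices run from $1$ to $4$. Let $h_{11}:\mathbb{R}\to(0,\infty)$ be smooth, $h^{11}=1/h_{11}$. Work in local coordinates $(t,x^i,y_1^i)$ of the $1$-jet space $J^1(\mathbb{R},M^4)$, $M^4$ a $4$-dimensional manifold, on the domain where $y_1^1y_1^2y_1^3y_1^4>0$. Put $g_{ij}=\frac{h_{11}}{2}\frac{\partial^2\mathring F^2}{\partial y_1^i\partial y_1^j}$, with inverse matrix $(g^{jk})$. The vertical components of the Cartan canonical connection are $$C_{j(k)}^{i(1)}=\sum_{m=1}^4\frac{g^{im}}{2}\left(\frac{\partial g_{jm}}{\partial y_1^k}+\frac{\partial g_{km}}{\partial y_1^j}-\frac{\partial g_{jk}}{\partial y_1^m}\right),$$ and they are given explicitly (no summation) by $$C_{j(k)}^{i(1)}=A_{jk}^i\frac{y_1^i}{y_1^jy_1^k},\qquad A_{jk}^i=\frac{2\delta_j^i+2\delta_k^i+2\delta_{jk}-8\delta_j^i\delta_{jk}-1}{8},$$ where $\delta$ is the Kronecker symbol. The vertical curvature d-tensor is $$S_{i(j)(k)}^{l(1)(1)}=\frac{\partial C_{i(j)}^{l(1)}}{\partial y_1^k}-\frac{\partial C_{i(k)}^{l(1)}}{\partial y_1^j}+\sum_{m=1}^4\left(C_{i(j)}^{m(1)}C_{m(k)}^{l(1)}-C_{i(k)}^{m(1)}C_{m(j)}^{l(1)}\right).$$ *)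

theory Defs
  imports "HOL-Analysis.Analysis"
begin

text \<open>
  Everything is expressed in an adapted chart \<open>(t, x, y)\<close> of the jet space
  \<open>J\<^sup>1(\<real>, M)\<close>, \<open>dim M = 4\<close>.  The metric function does not depend on the base
  coordinates \<open>x\<close>, so all objects below are functions of \<open>t :: real\<close> and
  \<open>y :: real ^ 4\<close> only.  Indices are elements of the four-element type \<open>4\<close>
  (whose numeral \<open>4\<close> denotes \<open>0\<close>, so that \<open>1, 2, 3, 4\<close> enumerate it).
\<close>

definition smooth_real :: "(real \<Rightarrow> real) \<Rightarrow> bool" where
  "smooth_real f \<longleftrightarrow> (\<forall>n t. ((deriv ^^ n) f) differentiable (at t))"

definition partial :: "4 \<Rightarrow> (real ^ 4 \<Rightarrow> real) \<Rightarrow> real ^ 4 \<Rightarrow> real" where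
  "partial k f y = deriv (\<lambda>s. f (y + s *\<^sub>R axis k 1)) 0"

definition berwald_moor :: "(real \<Rightarrow> real) \<Rightarrow> real \<Rightarrow> real ^ 4 \<Rightarrow> real" where
  "berwald_moor h11 t y = sqrt (1 / h11 t) * root 4 (y $ 1 * y $ 2 * y $ 3 * y $ 4)"

definition vertical_metric ::
    "(real \<Rightarrow> real) \<Rightarrow> (real \<Rightarrow> real ^ 4 \<Rightarrow> real) \<Rightarrow> real \<Rightarrow> real ^ 4 \<Rightarrow> real ^ 4 ^ 4" where
  "vertical_metric h11 F t y =
     (\<chi> i j. h11 t / 2 * partial i (partial j (\<lambda>z. (F t z)\<^sup>2)) y)"

text \<open>\<open>cartan_vertical h11 F t i j k y\<close> is \<open>C\<close> with upper index \<open>i\<close> and lower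
  indices \<open>j\<close> and \<open>(k)\<close>.\<close>

definition cartan_vertical ::
    "(real \<Rightarrow> real) \<Rightarrow> (real \<Rightarrow> real ^ 4 \<Rightarrow> real) \<Rightarrow> real \<Rightarrow> 4 \<Rightarrow> 4 \<Rightarrow> 4 \<Rightarrow> real ^ 4 \<Rightarrow> real" where
  "cartan_vertical h11 F t i j k y =
     (let g = vertical_metric h11 F t in
      \<Sum>m\<in>UNIV. matrix_inv (g y) $ i $ m / 2 *
        (partial k (\<lambda>z. g z $ j $ m) y
         + partial j (\<lambda>z. g z $ k $ m) y
         - partial m (\<lambda>z. g z $ j $ k) y))"

text \<open>\<open>vertical_curvature h11 F t l i j k y\<close> is \<open>S\<close> with upper index \<open>l\<close> and lower
  indices \<open>i\<close>, \<open>(j)\<close>, \<open>(k)\<close>.\<close>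

definition vertical_curvature ::
    "(real \<Rightarrow> real) \<Rightarrow> (real \<Rightarrow> real ^ 4 \<Rightarrow> real) \<Rightarrow> real \<Rightarrow> 4 \<Rightarrow> 4 \<Rightarrow> 4 \<Rightarrow> 4 \<Rightarrow> real ^ 4 \<Rightarrow> real"
  where
  "vertical_curvature h11 F t l i j k y =
     (let C = cartan_vertical h11 F t in
      partial k (C l i j) y - partial j (C l i k) y
      + (\<Sum>m\<in>UNIV. C m i j y * C l m k y - C m i k y * C l m j y))"

end

theory Submission
  imports Defs
begin

text \<open>
  On the domain where \<open>y\<^sup>1 y\<^sup>2 y\<^sup>3 y\<^sup>4 > 0\<close> every quantity in sight is a constant multiple of a
  monomial in the coordinates and in \<open>G = sqrt (y\<^sup>1 y\<^sup>2 y\<^sup>3 y\<^sup>4)\<close>, and differentiating a monomial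
  with respect to \<open>y\<^sup>k\<close> only multiplies it by its exponent and by \<open>1 / y\<^sup>k\<close>.  Thus all the
  tensors are computed by arithmetic on Kronecker symbols.

  Since \<open>F\<^sup>2 = G / h\<^sub>1\<^sub>1\<close>, the factor \<open>h\<^sub>1\<^sub>1\<close> cancels and
  \<open>g\<^sub>i\<^sub>j = G (1 - 2 \<delta>\<^sub>i\<^sub>j) / (8 y\<^sup>i y\<^sup>j)\<close> (lemma \<open>vertical_metric_berwald_moor\<close>).  With \<open>J\<close> the
  all-ones matrix of size 4 one has \<open>J\<^sup>2 = 4 J\<close>, hence \<open>(J - 2 I)\<^sup>2 = 4 I\<close>, which inverts the
  metric explicitly.  The Cartan coefficients come out as \<open>A y\<^sup>i / (y\<^sup>j y\<^sup>k)\<close> with constant \<open>A\<close>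
  (lemma \<open>cartan_vertical_berwald_moor\<close>).

  In the curvature, the contracted coordinate \<open>y\<^sup>m\<close> cancels from each product of Cartan
  coefficients, so the whole tensor is \<open>y\<^sup>l / (y\<^sup>i y\<^sup>j y\<^sup>k)\<close> times a constant depending on the
  indices alone.  That constant is
  \<open>((1 - 4 \<delta>\<^sub>i\<^sub>j) (1 - 4 \<delta>\<^sub>l\<^sub>k) - (1 - 4 \<delta>\<^sub>i\<^sub>k) (1 - 4 \<delta>\<^sub>l\<^sub>j)) / 64\<close>
  (lemma \<open>vertical_curvature_berwald_moor\<close>).  The shape has a geometric meaning: the angular
  metric \<open>g\<^sub>i\<^sub>j - h\<^sub>1\<^sub>1 (\<partial>\<^sub>i F) (\<partial>\<^sub>j F)\<close> equals \<open>G (1 - 4 \<delta>\<^sub>i\<^sub>j) / (16 y\<^sup>i y\<^sup>j)\<close>, and the curvature is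
  built from it as the curvature tensor of a space of constant curvature is built from its
  metric.  The ten cases are the values of this one expression for
  the possible coincidences among the indices.
\<close>

section \<open>Monomials and their partial derivatives\<close>

definition coord_product :: "real ^ 4 \<Rightarrow> real" where
  "coord_product y = y $ 1 * y $ 2 * y $ 3 * y $ 4"

definition kronecker :: "4 \<Rightarrow> 4 \<Rightarrow> real" where
  "kronecker i j = (if i = j then 1 else 0)"

text \<open>
  The number \<open>a\<close> is the logarithmic derivative \<open>y\<^sup>k (\<partial>\<^sub>k f) / f\<close>; for a monomial it is the
  exponent of \<open>y\<^sup>k\<close>.  It is stated without dividing by \<open>f y\<close>, so that \<open>f y = 0\<close> is harmless.
\<close>

definition has_exponent :: "4 \<Rightarrow> (real ^ 4 \<Rightarrow> real) \<Rightarrow> real ^ 4 \<Rightarrow> real \<Rightarrow> bool" where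
  "has_exponent k f y a \<longleftrightarrow>
     ((\<lambda>s. f (y + s *\<^sub>R axis k 1)) has_real_derivative a * f y / y $ k) (at 0)"

lemma coord_product_pos_imp_nonzero:
  assumes "coord_product y > 0"
  shows "y $ i \<noteq> 0"
  using assms exhaust_4[of i] by (auto simp: coord_product_def)

lemma kronecker_commute: "kronecker i j = kronecker j i"
  by (simp add: kronecker_def)

lemma has_exponent_const: "has_exponent k (\<lambda>_. c) y 0"
  by (simp add: has_exponent_def)

lemma has_exponent_coord:
  assumes "y $ k \<noteq> 0"
  shows "has_exponent k (\<lambda>z. z $ i) y (kronecker i k)"
proof -
  have "((\<lambda>s. y $ i + s * kronecker i k) has_real_derivative kronecker i k) (at 0)"
    by (auto intro!: derivative_eq_intros)
  moreover have "(\<lambda>s. (y + s *\<^sub>R axis k 1) $ i) = (\<lambda>s. y $ i + s * kronecker i k)"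
    by (auto simp: axis_def kronecker_def)
  moreover have "kronecker i k = kronecker i k * y $ i / y $ k"
    using assms by (auto simp: kronecker_def)
  ultimately show ?thesis
    unfolding has_exponent_def by simp
qed

lemma has_exponent_mult:
  assumes "has_exponent k f y a" "has_exponent k g y b"
  shows "has_exponent k (\<lambda>z. f z * g z) y (a + b)"
  using DERIV_mult[OF assms[unfolded has_exponent_def]]
  by (simp add: has_exponent_def algebra_simps add_divide_distrib)

lemma has_exponent_divide:
  assumes "has_exponent k f y a" "has_exponent k g y b" "g y \<noteq> 0"
  shows "has_exponent k (\<lambda>z. f z / g z) y (a - b)"
proof -
  have "((\<lambda>s. f (y + s *\<^sub>R axis k 1) / g (y + s *\<^sub>R axis k 1)) has_real_derivative
          (a * f y / y $ k * g y - f y * (b * g y / y $ k)) / (g y * g y)) (at 0)"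
    using DERIV_divide[OF assms(1,2)[unfolded has_exponent_def]] assms(3) by simp
  moreover have "(a * f y / y $ k * g y - f y * (b * g y / y $ k)) / (g y * g y)
      = (a - b) * (f y / g y) / y $ k"
    using assms(3) by (cases "y $ k = 0") (simp_all add: field_simps)
  ultimately show ?thesis
    unfolding has_exponent_def by simp
qed

lemma has_exponent_sqrt:
  assumes "has_exponent k f y a" "f y > 0"
  shows "has_exponent k (\<lambda>z. sqrt (f z)) y (a / 2)"
proof -
  have "((\<lambda>s. sqrt (f (y + s *\<^sub>R axis k 1))) has_real_derivative
          inverse (sqrt (f y)) / 2 * (a * f y / y $ k)) (at 0)"
    using DERIV_chain2[OF DERIV_real_sqrt assms(1)[unfolded has_exponent_def]] assms(2) by simp
  moreover have "inverse (sqrt (f y)) / 2 * (a * f y / y $ k) = a / 2 * sqrt (f y) / y $ k"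
  proof -
    have "inverse (sqrt (f y)) * f y = sqrt (f y)"
      using assms(2) by (simp add: real_div_sqrt divide_inverse_commute[symmetric])
    moreover have "inverse (sqrt (f y)) / 2 * (a * f y / y $ k)
        = inverse (sqrt (f y)) * f y * (a / (2 * y $ k))"
      by simp
    ultimately show ?thesis
      by simp
  qed
  ultimately show ?thesis
    unfolding has_exponent_def by (simp only:)
qed

lemma has_exponent_coord_product:
  assumes "coord_product y > 0"
  shows "has_exponent k coord_product y 1"
proof -
  note coord = has_exponent_coord[OF coord_product_pos_imp_nonzero[OF assms]]
  have "has_exponent k coord_product y
      (kronecker 1 k + kronecker 2 k + kronecker 3 k + kronecker 4 k)"
    unfolding coord_product_def[abs_def] by (intro has_exponent_mult coord)
  moreover have "kronecker 1 k + kronecker 2 k + kronecker 3 k + kronecker 4 k = 1"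
    using exhaust_4[of k] by (auto simp: kronecker_def)
  ultimately show ?thesis
    by simp
qed

text \<open>
  The function \<open>f\<close> need agree with the monomial \<open>g\<close> only on the domain, because that domain is
  open along each coordinate line.
\<close>

lemma partial_eq:
  assumes y: "coord_product y > 0"
    and eq: "\<And>z. coord_product z > 0 \<Longrightarrow> f z = g z"
    and g: "has_exponent k g y a"
  shows "partial k f y = a * g y / y $ k"
proof -
  have "isCont (\<lambda>s. coord_product (y + s *\<^sub>R axis k 1)) 0"
    using has_exponent_coord_product[OF y] DERIV_isCont unfolding has_exponent_def by blast
  then have "eventually (\<lambda>s. 0 < coord_product (y + s *\<^sub>R axis k 1)) (nhds 0)"
    using y order_tendstoD(1)[of "\<lambda>s. coord_product (y + s *\<^sub>R axis k 1)" _ "at 0" 0]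
    by (simp add: isCont_def eventually_nhds_conv_at)
  then have "eventually (\<lambda>s. f (y + s *\<^sub>R axis k 1) = g (y + s *\<^sub>R axis k 1)) (nhds 0)"
    by eventually_elim (rule eq)
  then have "partial k f y = deriv (\<lambda>s. g (y + s *\<^sub>R axis k 1)) 0"
    unfolding partial_def by (rule deriv_cong_ev) simp
  also have "\<dots> = a * g y / y $ k"
    using g unfolding has_exponent_def by (rule DERIV_imp_deriv)
  finally show ?thesis .
qed

section \<open>The metric and its inverse\<close>

lemma berwald_moor_square:
  assumes "h11 t > 0" "coord_product z > 0"
  shows "(berwald_moor h11 t z)\<^sup>2 = 1 / h11 t * sqrt (coord_product z)"
proof -
  have "root 4 (coord_product z) = sqrt (sqrt (coord_product z))"
    using real_root_mult_exp[of 2 2 "coord_product z"] by (simp add: sqrt_def)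
  then show ?thesis
    using assms by (simp add: berwald_moor_def coord_product_def[symmetric] power_mult_distrib)
qed

lemma has_exponent_metric_monomial:
  assumes "coord_product y > 0"
  shows "has_exponent k (\<lambda>z. c * sqrt (coord_product z) / (z $ i * z $ j)) y
           (1 / 2 - kronecker i k - kronecker j k)"
proof -
  note nz = coord_product_pos_imp_nonzero[OF assms]
  have "has_exponent k (\<lambda>z. c * sqrt (coord_product z) / (z $ i * z $ j)) y
          (0 + 1 / 2 - (kronecker i k + kronecker j k))"
    by (intro has_exponent_mult has_exponent_divide has_exponent_const has_exponent_sqrt
        has_exponent_coord has_exponent_coord_product) (use assms nz in auto)
  then show ?thesis
    by (simp add: algebra_simps)
qed

lemma vertical_metric_berwald_moor:
  assumes "h11 t > 0" "coord_product y > 0"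
  shows "vertical_metric h11 (berwald_moor h11) t y $ i $ j
           = (1 - 2 * kronecker i j) / 8 * sqrt (coord_product y) / (y $ i * y $ j)"
proof -
  have first: "partial j (\<lambda>z. (berwald_moor h11 t z)\<^sup>2) z
      = 1 / (2 * h11 t) * sqrt (coord_product z) / z $ j"
    if z: "coord_product z > 0" for z
  proof -
    have "has_exponent j (\<lambda>z. 1 / h11 t * sqrt (coord_product z)) z (0 + 1 / 2)"
      by (intro has_exponent_mult has_exponent_const has_exponent_sqrt
          has_exponent_coord_product z)
    from partial_eq[OF z berwald_moor_square[where ?h11.0 = h11 and t = t] this] assms(1)
    show ?thesis by simp
  qed
  have "has_exponent i (\<lambda>z. 1 / (2 * h11 t) * sqrt (coord_product z) / z $ j) y
          (0 + 1 / 2 - kronecker j i)"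
    by (intro has_exponent_mult has_exponent_divide has_exponent_const has_exponent_sqrt
        has_exponent_coord has_exponent_coord_product)
      (use assms coord_product_pos_imp_nonzero in auto)
  from partial_eq[OF assms(2) first this]
  have second: "partial i (partial j (\<lambda>z. (berwald_moor h11 t z)\<^sup>2)) y
      = (1 / 2 - kronecker i j) * (1 / (2 * h11 t) * sqrt (coord_product y) / y $ j) / y $ i"
    unfolding kronecker_commute[of j i] by simp
  have "vertical_metric h11 (berwald_moor h11) t y $ i $ j
      = h11 t / 2 * partial i (partial j (\<lambda>z. (berwald_moor h11 t z)\<^sup>2)) y"
    by (simp add: vertical_metric_def)
  also have "\<dots> = (1 - 2 * kronecker i j) / 8 * sqrt (coord_product y) / (y $ i * y $ j)"
    unfolding second
    using assms(1) coord_product_pos_imp_nonzero[OF assms(2)] by (simp add: field_simps)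
  finally show ?thesis .
qed

lemma matrix_inv_eqI:
  fixes A B :: "'a :: field ^ 'n ^ 'n"
  assumes "A ** B = mat 1"
  shows "matrix_inv A = B"
proof -
  have "A ** B = mat 1 \<and> B ** A = mat 1"
    using assms matrix_left_right_inverse by blast
  then have "A ** matrix_inv A = mat 1 \<and> matrix_inv A ** A = mat 1"
    unfolding matrix_inv_def by (rule someI)
  then have "matrix_inv A = matrix_inv A ** (A ** B)" "matrix_inv A ** A = mat 1"
    using assms by simp_all
  then show ?thesis
    by (metis matrix_mul_assoc matrix_mul_lid)
qed

lemma matrix_inv_vertical_metric_berwald_moor:
  assumes "h11 t > 0" and y: "coord_product y > 0"
  shows "matrix_inv (vertical_metric h11 (berwald_moor h11) t y) $ i $ j
           = 2 * (1 - 2 * kronecker i j) * (y $ i * y $ j) / sqrt (coord_product y)"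
proof -
  define B :: "real ^ 4 ^ 4" where
    "B = (\<chi> i j. 2 * (1 - 2 * kronecker i j) * (y $ i * y $ j) / sqrt (coord_product y))"
  note nz = coord_product_pos_imp_nonzero[OF y]
  let ?g = "vertical_metric h11 (berwald_moor h11) t y"
  \<comment> \<open>This is \<open>(J - 2 I)\<^sup>2 = 4 I\<close> for the all-ones matrix \<open>J\<close> of size 4.\<close>
  have square: "(\<Sum>m\<in>UNIV. (1 - 2 * kronecker i m) * (1 - 2 * kronecker m j)) = 4 * kronecker i j"
    for i j
    using exhaust_4[of i] exhaust_4[of j] by (auto simp: sum_4 kronecker_def)
  have "(\<Sum>m\<in>UNIV. ?g $ i $ m * B $ m $ j) = (if i = j then 1 else 0)" for i j
  proof -
    have "(\<Sum>m\<in>UNIV. ?g $ i $ m * B $ m $ j)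
        = (\<Sum>m\<in>UNIV. (1 - 2 * kronecker i m) * (1 - 2 * kronecker m j) * (y $ j / (4 * y $ i)))"
    proof (rule sum.cong[OF refl])
      fix m
      have cancel: "u / 8 * r / (y $ i * y $ m) * (2 * v * (y $ m * y $ j) / r)
          = u * v * (y $ j / (4 * y $ i))" if "r \<noteq> 0" for u v r :: real
        using nz that by (simp add: field_simps)
      show "?g $ i $ m * B $ m $ j
          = (1 - 2 * kronecker i m) * (1 - 2 * kronecker m j) * (y $ j / (4 * y $ i))"
        unfolding vertical_metric_berwald_moor[where ?h11.0 = h11 and t = t, OF assms] B_def
          vec_lambda_beta
        by (rule cancel) (use y in simp)
    qed
    also have "\<dots> = (\<Sum>m\<in>UNIV. (1 - 2 * kronecker i m) * (1 - 2 * kronecker m j))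
          * (y $ j / (4 * y $ i))"
      by (rule sum_distrib_right[symmetric])
    also have "\<dots> = kronecker i j * (y $ j / y $ i)"
      by (simp add: square)
    finally show ?thesis
      using nz by (simp add: kronecker_def)
  qed
  then have "?g ** B = mat 1"
    by (simp add: matrix_matrix_mult_def mat_def vec_eq_iff)
  then have "matrix_inv ?g = B"
    by (rule matrix_inv_eqI)
  then show ?thesis
    by (simp add: B_def)
qed

section \<open>The Cartan coefficients\<close>

definition cartan_coeff :: "4 \<Rightarrow> 4 \<Rightarrow> 4 \<Rightarrow> real" where
  "cartan_coeff i j k =
     (2 * kronecker i j + 2 * kronecker i k + 2 * kronecker j k
       - 8 * kronecker i j * kronecker j k - 1) / 8"

lemma partial_vertical_metric_berwald_moor:
  assumes "h11 t > 0" and y: "coord_product y > 0"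
  shows "partial k (\<lambda>z. vertical_metric h11 (berwald_moor h11) t z $ i $ j) y
           = (1 - 2 * kronecker i j) * (1 / 2 - kronecker i k - kronecker j k)
               * (sqrt (coord_product y) / (8 * y $ i * y $ j * y $ k))"
  using partial_eq[OF y vertical_metric_berwald_moor[where ?h11.0 = h11 and t = t, OF assms(1)]
      has_exponent_metric_monomial[OF y]]
  by (simp add: ac_simps)

lemma cartan_vertical_berwald_moor:
  assumes "h11 t > 0" and y: "coord_product y > 0"
  shows "cartan_vertical h11 (berwald_moor h11) t i j k y
           = cartan_coeff i j k * y $ i / (y $ j * y $ k)"
proof -
  \<comment> \<open>The constant factor of the derivative of \<open>g\<^sub>i\<^sub>j\<close> with respect to \<open>y\<^sup>k\<close>.\<close>
  define c :: "4 \<Rightarrow> 4 \<Rightarrow> 4 \<Rightarrow> real" where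
    "c k i j = (1 - 2 * kronecker i j) * (1 / 2 - kronecker i k - kronecker j k)" for k i j
  note nz = coord_product_pos_imp_nonzero[OF y]
  have "cartan_vertical h11 (berwald_moor h11) t i j k y
      = (\<Sum>m\<in>UNIV. (1 - 2 * kronecker i m) * (c k j m + c j k m - c m j k)
           * (y $ i / (8 * y $ j * y $ k)))"
    unfolding cartan_vertical_def Let_def
  proof (rule sum.cong[OF refl])
    fix m
    have cancel: "2 * a * (y $ i * y $ m) / r / 2 *
        (p * (r / (8 * y $ j * y $ m * y $ k)) + q * (r / (8 * y $ k * y $ m * y $ j))
          - s * (r / (8 * y $ j * y $ k * y $ m)))
        = a * (p + q - s) * (y $ i / (8 * y $ j * y $ k))" if "r \<noteq> 0" for a p q s r :: real
      using nz that by (simp add: field_simps)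
    show "matrix_inv (vertical_metric h11 (berwald_moor h11) t y) $ i $ m / 2 *
        (partial k (\<lambda>z. vertical_metric h11 (berwald_moor h11) t z $ j $ m) y
         + partial j (\<lambda>z. vertical_metric h11 (berwald_moor h11) t z $ k $ m) y
         - partial m (\<lambda>z. vertical_metric h11 (berwald_moor h11) t z $ j $ k) y)
      = (1 - 2 * kronecker i m) * (c k j m + c j k m - c m j k) * (y $ i / (8 * y $ j * y $ k))"
      unfolding partial_vertical_metric_berwald_moor[where ?h11.0 = h11 and t = t, OF assms]
        matrix_inv_vertical_metric_berwald_moor[where ?h11.0 = h11 and t = t, OF assms] c_def
      by (rule cancel) (use y in simp)
  qed
  also have "\<dots> = (\<Sum>m\<in>UNIV. (1 - 2 * kronecker i m) * (c k j m + c j k m - c m j k))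
           * (y $ i / (8 * y $ j * y $ k))"
    by (rule sum_distrib_right[symmetric])
  also have "(\<Sum>m\<in>UNIV. (1 - 2 * kronecker i m) * (c k j m + c j k m - c m j k))
      = 8 * cartan_coeff i j k"
    unfolding sum_4 c_def cartan_coeff_def kronecker_def
    using exhaust_4[of i] exhaust_4[of j] exhaust_4[of k]
    by (elim disjE) simp_all
  finally show ?thesis
    by simp
qed

section \<open>The curvature\<close>

text \<open>
  The left-hand side is what remains of the curvature once the monomial
  \<open>y\<^sup>l / (y\<^sup>i y\<^sup>j y\<^sup>k)\<close> has been factored out: logarithmic derivatives of the Cartan
  coefficients, and a contraction of their constants.  The identity is special to four
  indices, and it is verified on each index tuple.
\<close>

lemma curvature_coeff:
  "cartan_coeff l i j * (kronecker l k - kronecker i k - kronecker j k)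
     - cartan_coeff l i k * (kronecker l j - kronecker i j - kronecker k j)
     + (\<Sum>m\<in>UNIV. cartan_coeff m i j * cartan_coeff l m k
                    - cartan_coeff m i k * cartan_coeff l m j)
   = ((1 - 4 * kronecker i j) * (1 - 4 * kronecker l k)
      - (1 - 4 * kronecker i k) * (1 - 4 * kronecker l j)) / 64"
  unfolding sum_4 cartan_coeff_def kronecker_def
  using exhaust_4[of i] exhaust_4[of j] exhaust_4[of k] exhaust_4[of l]
  by (elim disjE) simp_all

lemma partial_cartan_vertical_berwald_moor:
  assumes "h11 t > 0" and y: "coord_product y > 0"
  shows "partial k (cartan_vertical h11 (berwald_moor h11) t l i j) y
           = cartan_coeff l i j * (kronecker l k - kronecker i k - kronecker j k)
               * (y $ l / (y $ i * y $ j * y $ k))"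
proof -
  note nz = coord_product_pos_imp_nonzero[OF y]
  have "has_exponent k (\<lambda>z. cartan_coeff l i j * z $ l / (z $ i * z $ j)) y
          (0 + kronecker l k - (kronecker i k + kronecker j k))"
    by (intro has_exponent_mult has_exponent_divide has_exponent_const has_exponent_coord)
      (use nz in auto)
  from partial_eq[OF y cartan_vertical_berwald_moor[where ?h11.0 = h11 and t = t, OF assms(1)] this]
  show ?thesis by (simp add: diff_diff_eq mult_ac)
qed

text \<open>
  In every product of two Cartan coefficients the contracted coordinate \<open>y\<^sup>m\<close> cancels, leaving
  the same monomial that the derivative terms carry.
\<close>

lemma vertical_curvature_berwald_moor:
  assumes "h11 t > 0" and y: "coord_product y > 0"
  shows "vertical_curvature h11 (berwald_moor h11) t l i j k y
           = ((1 - 4 * kronecker i j) * (1 - 4 * kronecker l k)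
              - (1 - 4 * kronecker i k) * (1 - 4 * kronecker l j)) / 64
             * (y $ l / (y $ i * y $ j * y $ k))"
proof -
  note nz = coord_product_pos_imp_nonzero[OF y]
  let ?C = "cartan_vertical h11 (berwald_moor h11) t"
  let ?A = cartan_coeff
  let ?w = "y $ l / (y $ i * y $ j * y $ k)"
  have product: "?C m i j y * ?C l m k y - ?C m i k y * ?C l m j y
      = (?A m i j * ?A l m k - ?A m i k * ?A l m j) * ?w" for m
  proof -
    have cancel: "p * y $ m / (y $ i * y $ j) * (q * y $ l / (y $ m * y $ k))
        - r * y $ m / (y $ i * y $ k) * (s * y $ l / (y $ m * y $ j)) = (p * q - r * s) * ?w"
      for p q r s
      using nz by (simp add: field_simps)
    show ?thesis
      unfolding cartan_vertical_berwald_moor[where ?h11.0 = h11 and t = t, OF assms]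
      by (rule cancel)
  qed
  have "vertical_curvature h11 (berwald_moor h11) t l i j k y
      = ?A l i j * (kronecker l k - kronecker i k - kronecker j k) * ?w
        - ?A l i k * (kronecker l j - kronecker i j - kronecker k j) * ?w
        + (\<Sum>m\<in>UNIV. ?A m i j * ?A l m k - ?A m i k * ?A l m j) * ?w"
    unfolding vertical_curvature_def Let_def product sum_distrib_right[symmetric]
      partial_cartan_vertical_berwald_moor[where ?h11.0 = h11 and t = t, OF assms]
    by (simp add: mult.commute mult.left_commute)
  then show ?thesis
    unfolding curvature_coeff[symmetric] by (simp only: distrib_right left_diff_distrib)
qed

theorem theorem4p7:
  fixes h11 :: "real \<Rightarrow> real" and t :: real and y :: "real ^ 4"
    and S :: "4 \<Rightarrow> 4 \<Rightarrow> 4 \<Rightarrow> 4 \<Rightarrow> real"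
  assumes "smooth_real h11"
    and "\<And>s. h11 s > 0"
    and "y $ 1 * y $ 2 * y $ 3 * y $ 4 > 0"
  defines "S \<equiv> (\<lambda>l i j k. vertical_curvature h11 (berwald_moor h11) t l i j k y)"
  shows "(\<forall>i j k l. distinct [i, j, k, l] \<longrightarrow> S l i j k = 0)
    \<and> (\<forall>i k l. distinct [i, k, l] \<longrightarrow> S l i i k = - (1 / 16) * (y $ l / ((y $ i)\<^sup>2 * y $ k)))
    \<and> (\<forall>i j l. distinct [i, j, l] \<longrightarrow> S l i j i = 1 / 16 * (y $ l / ((y $ i)\<^sup>2 * y $ j)))
    \<and> (\<forall>i j k. distinct [i, j, k] \<longrightarrow> S i i j k = 0)
    \<and> (\<forall>i k l. distinct [i, k, l] \<longrightarrow> S l i l k = 1 / (16 * y $ i * y $ k))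
    \<and> (\<forall>i j l. distinct [i, j, l] \<longrightarrow> S l i j l = - (1 / (16 * y $ i * y $ j)))
    \<and> (\<forall>i l. i \<noteq> l \<longrightarrow> S l i i l = 1 / (8 * (y $ i)\<^sup>2))
    \<and> (\<forall>i l. i \<noteq> l \<longrightarrow> S l i l i = - (1 / (8 * (y $ i)\<^sup>2)))
    \<and> (\<forall>k l. k \<noteq> l \<longrightarrow> S l l l k = 0)
    \<and> (\<forall>j l. j \<noteq> l \<longrightarrow> S l l j l = 0)"
proof -
  have y: "coord_product y > 0"
    using assms(3) by (simp add: coord_product_def)
  have S: "S l i j k = ((1 - 4 * kronecker i j) * (1 - 4 * kronecker l k)
      - (1 - 4 * kronecker i k) * (1 - 4 * kronecker l j)) / 64
      * (y $ l / (y $ i * y $ j * y $ k))" for l i j k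
    unfolding S_def by (rule vertical_curvature_berwald_moor[where ?h11.0 = h11 and t = t, OF assms(2) y])
  show ?thesis
    unfolding S kronecker_def
    using coord_product_pos_imp_nonzero[OF y]
    by (intro conjI allI impI) (auto simp: power2_eq_square)
qed

end
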